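(* Let $n\ge 1$ and $m\geq 2$ be integers and let $f:\mathbb{D}^n\rightarrow\mathbb{B}_m$ be a holomorphic mapping. Then for any $z=(z_1,\cdots,z_n)\in\mathbb{D}^n$: $$\sum^n_{j=1}(1-|z_j|^2)\,|\nabla_j|f|(z)|\leq 1-|f(z)|^2 \quad\text{if } f(z)\neq 0,$$ and $$\sum^n_{j=1}(1-|z_j|^2)^2\,|\nabla_j|f|(z)|^2\leq 1 \quad\text{if } f(z)=0.$$
   Context: $\mathbb{D}$ is the (open) unit disk in $\mathbb{C}$, $\mathbb{D}^n$ is the (open) unit polydisk in $\mathbb{C}^n$, and $\mathbb{B}_m$ is the (open) unit ball in $\mathbb{C}^m$ for the Euclidean norm. For $z=(z_1,\cdots,z_k)$ and $z'=(z_1',\cdots,z_k')$ in $\mathbb{C}^k$, $\langle z,z'\rangle=z_1\overline{z_1'}+\cdots+z_k\overline{z_k'}$ and $|z|=\langle z,z\rangle^{1/2}$. For a holomorphic mapping $f=(f_1,\cdots,f_m)$ on a domain $X\subset\mathbb{C}^n$, $|f|$ denotes the real-valued function $|f|(z)=|f(z)|=(|f_1(z)|^2+\cdots+|f_m(z)|^2)^{1/2}$. For $j=1,\cdots,n$ and $z=(z_1,\cdots,z_n)\in X$, the quantity $|\nabla_j|f|(z)|$ is defined by $$|\nabla_j|f|(z)|=\sup_{\beta\in\mathbb{C},\,|\beta|=1}\left(\lim_{t\in\mathbb{R},\,t\rightarrow 0^+}\frac{|f|(z_1,\cdots,z_{j-1},z_j+t\beta,z_{j+1},\cdots,z_n)-|f|(z)}{t}\right).$$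 *)

theory Defs
  imports "HOL-Analysis.Analysis"
begin

definition unit_polydisk :: "(complex ^ 'n::finite) set" where
  "unit_polydisk = {z. \<forall>j. norm (z $ j) < 1}"

text \<open>
  The library's \<open>holomorphic_on\<close> covers one complex variable only. A mapping of several
  variables is holomorphic if it is Frechet differentiable with complex-linear derivative at
  every point; real linearity is part of \<open>has_derivative\<close>.
\<close>
definition holomorphic_map_on ::
    "(complex ^ 'n::finite \<Rightarrow> complex ^ 'm::finite) \<Rightarrow> (complex ^ 'n) set \<Rightarrow> bool" where
  "holomorphic_map_on f X \<longleftrightarrow>
     (\<forall>z\<in>X. \<exists>L. (f has_derivative L) (at z within X) \<and> (\<forall>c v. L (c *s v) = c *s L v))"

text \<open>
  \<open>nabla_abs j u z\<close> is the quantity $|\nabla_j u(z)|$ of a real-valued function \<open>u\<close>. \<open>Lim\<close> and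
  the real supremum are meaningful only if the one-sided directional derivatives exist and are
  bounded in \<open>\<beta>\<close>. Both hold for \<open>u = (\<lambda>w. norm (f w))\<close> with \<open>f\<close> holomorphic near \<open>z\<close>, also at
  zeros of \<open>f\<close>.
\<close>
definition nabla_abs :: "'n::finite \<Rightarrow> (complex ^ 'n \<Rightarrow> real) \<Rightarrow> complex ^ 'n \<Rightarrow> real" where
  "nabla_abs j u z =
     (SUP \<beta>\<in>{\<beta>::complex. norm \<beta> = 1}.
        Lim (at_right (0::real)) (\<lambda>t. (u (z + axis j (of_real t * \<beta>)) - u z) / t))"

end

theory Submission
  imports Defs "HOL-Complex_Analysis.Riemann_Mapping"
begin

text \<open>
  Both inequalities follow from the Schwarz-Pick inequality in one complex variable, applied along
  well-chosen analytic discs. Let \<open>r\<^sub>j = 1 - |z\<^sub>j|\<^sup>2\<close> and let \<open>\<partial>\<^sub>j f\<close> be the value at the \<open>j\<close>-th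
  standard basis vector of the derivative of \<open>f\<close> at \<open>z\<close>. For unimodular numbers \<open>\<zeta>\<^sub>j\<close>, the disc
  whose \<open>j\<close>-th coordinate is the Moebius map \<open>w \<mapsto> (\<zeta>\<^sub>j w + z\<^sub>j) / (1 + cnj z\<^sub>j \<zeta>\<^sub>j w)\<close> lies in the
  polydisk and passes through \<open>z\<close> at \<open>w = 0\<close> with velocity \<open>(\<zeta>\<^sub>j r\<^sub>j)\<^sub>j\<close>. Composing with \<open>f\<close> and
  pairing with a vector \<open>e\<close> of norm at most 1 gives a holomorphic self-map of the unit disc, so
  \<open>|\<langle>\<Sum>\<^sub>j \<zeta>\<^sub>j r\<^sub>j \<partial>\<^sub>j f, e\<rangle>| \<le> 1 - |\<langle>f z, e\<rangle>|\<^sup>2\<close>; this is \<open>polydisk_Schwarz_Pick\<close>. The numbers \<open>\<zeta>\<^sub>j\<close> and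
  the vector \<open>e\<close> can be chosen freely.

  If \<open>f z \<noteq> 0\<close>, let \<open>e\<close> be the direction of \<open>f z\<close>. The right-hand side becomes \<open>1 - |f z|\<^sup>2\<close>, the
  quantity \<open>|\<nabla>\<^sub>j |f| (z)|\<close> is at most \<open>|\<langle>\<partial>\<^sub>j f, e\<rangle>|\<close> because the derivative of the norm at
  \<open>f z\<close> is the real part of the pairing with \<open>e\<close>, and suitable \<open>\<zeta>\<^sub>j\<close> make all summands
  \<open>\<zeta>\<^sub>j r\<^sub>j \<langle>\<partial>\<^sub>j f, e\<rangle>\<close> nonnegative.

  If \<open>f z = 0\<close>, then \<open>|\<nabla>\<^sub>j |f| (z)| = |\<partial>\<^sub>j f|\<close>. Taking for \<open>e\<close> the direction of the vector
  \<open>\<Sum>\<^sub>j \<zeta>\<^sub>j r\<^sub>j \<partial>\<^sub>j f\<close> shows that this vector has norm at most 1 for all unimodular \<open>\<zeta>\<^sub>j\<close>. The mean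
  of its squared norm over all choices of signs is \<open>\<Sum>\<^sub>j r\<^sub>j\<^sup>2 |\<partial>\<^sub>j f|\<^sup>2\<close>, so this sum is at most 1;
  \<open>signs_norm_sum_ge\<close> finds signs for which the squared norm is at least the mean.
\<close>

section \<open>The Hermitian pairing\<close>

text \<open>
  Conjugation falls on the second argument, so that \<open>w \<mapsto> hermitian (f w) e\<close> is holomorphic
  whenever \<open>f\<close> is.
\<close>

definition hermitian :: "complex ^ 'm::finite \<Rightarrow> complex ^ 'm \<Rightarrow> complex" where
  "hermitian x e = (\<Sum>i\<in>UNIV. x $ i * cnj (e $ i))"

lemma hermitian_smult: "hermitian (c *s x) e = c * hermitian x e"
  by (simp add: hermitian_def sum_distrib_left mult.assoc)

lemma hermitian_scaleR_right: "hermitian x (r *\<^sub>R e) = of_real r * hermitian x e"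
  by (simp add: hermitian_def sum_distrib_left scaleR_conv_of_real[where 'a = complex] mult_ac)

lemma Re_hermitian: "Re (hermitian x e) = x \<bullet> e"
  by (simp add: hermitian_def inner_vec_def inner_complex_def)

lemma hermitian_self: "hermitian x x = of_real ((norm x)\<^sup>2)"
proof -
  have "(norm x)\<^sup>2 = (\<Sum>i\<in>UNIV. (norm (x $ i))\<^sup>2)"
    by (simp add: norm_vec_def L2_set_def sum_nonneg)
  then show ?thesis
    by (simp only: hermitian_def complex_norm_square of_real_sum)
qed

lemma hermitian_sgn: "hermitian x (sgn x) = of_real (norm x)"
  by (cases "x = 0")
     (auto simp: hermitian_def[of 0] sgn_div_norm hermitian_scaleR_right hermitian_self power2_eq_square)

lemma norm_hermitian_le: "norm (hermitian x e) \<le> norm x * norm e"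
proof -
  have "norm (hermitian x e) \<le> (\<Sum>i\<in>UNIV. norm (x $ i) * norm (e $ i))"
    unfolding hermitian_def by (rule sum_norm_le) (simp add: norm_mult)
  also have "\<dots> \<le> norm x * norm e"
    using L2_set_mult_ineq[of "\<lambda>i. norm (x $ i)" "\<lambda>i. norm (e $ i)" UNIV]
    by (simp add: norm_vec_def)
  finally show ?thesis .
qed

lemma bounded_linear_hermitian: "bounded_linear (\<lambda>x. hermitian x e)"
proof (rule bounded_linear_intro)
  show "norm (hermitian x e) \<le> norm x * norm e" for x
    by (rule norm_hermitian_le)
qed (simp_all add: hermitian_def sum.distrib distrib_right scaleR_right.sum)

lemma norm_vector_smult: "norm (c *s x) = norm c * norm (x :: complex ^ 'm::finite)"
proof -
  have "(norm (c *s x))\<^sup>2 = (norm c * norm x)\<^sup>2"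
    by (simp add: norm_vec_def L2_set_def sum_nonneg power_mult_distrib norm_mult sum_distrib_left)
  then show ?thesis
    by (simp add: power2_eq_iff_nonneg)
qed

section \<open>The Schwarz-Pick inequality along analytic discs\<close>

text \<open>
  The Moebius map that sends \<open>g 0\<close> to \<open>0\<close> has derivative \<open>1 / (1 - |g 0|\<^sup>2)\<close> there. Its
  composition with \<open>g\<close> vanishes at \<open>0\<close> and falls under the Schwarz lemma.
\<close>
lemma Schwarz_Pick_at_0:
  assumes holg: "g holomorphic_on ball 0 1" and g1: "\<And>w. norm w < 1 \<Longrightarrow> norm (g w) < 1"
  shows "norm (deriv g 0) \<le> 1 - (norm (g 0))\<^sup>2"
proof -
  define a where "a = g 0"
  have a: "norm a < 1" using g1[of 0] by (simp add: a_def)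
  define r where "r = 1 - (norm a)\<^sup>2"
  have r: "r > 0" using a by (simp add: r_def power_less_one_iff)
  have r': "1 - cnj a * a = of_real r"
    unfolding r_def of_real_diff complex_norm_square by (simp add: mult.commute)
  let ?M = "Moebius_function 0 a"
  have M': "(?M has_field_derivative 1 / of_real r) (at a)"
    unfolding Moebius_function_simple[abs_def]
    by (rule derivative_eq_intros refl | use r in \<open>simp add: r'\<close>)+
  have g': "(g has_field_derivative deriv g 0) (at 0)"
    by (rule holomorphic_derivI[OF holg]) auto
  have "((\<lambda>w. ?M (g w)) has_field_derivative 1 / of_real r * deriv g 0) (at 0)"
    by (rule DERIV_chain2[OF _ g']) (use M' in \<open>simp add: a_def\<close>)
  then have D: "deriv (\<lambda>w. ?M (g w)) 0 = 1 / of_real r * deriv g 0"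
    by (rule DERIV_imp_deriv)
  have le: "norm (deriv (\<lambda>w. ?M (g w)) 0) \<le> 1"
  proof (rule Schwarz_Lemma(2)[where \<xi> = 0])
    have "(?M \<circ> g) holomorphic_on ball 0 1"
      by (rule holomorphic_on_compose_gen[OF holg Moebius_function_holomorphic[OF a]])
         (use g1 in auto)
    then show "(\<lambda>w. ?M (g w)) holomorphic_on ball 0 1" by (simp add: o_def)
    show "?M (g 0) = 0" by (simp add: a_def Moebius_function_eq_zero)
    show "norm (?M (g w)) < 1" if "norm w < 1" for w
      using Moebius_function_norm_lt_1[OF a g1[OF that]] .
  qed auto
  have "norm (deriv g 0) / r \<le> 1"
    using le r unfolding D by (simp add: norm_mult norm_divide)
  then show ?thesis
    using r by (simp add: r_def a_def)
qed

text \<open>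
  The derivative of a map from the complex plane to \<open>complex ^ 'n\<close>, written with \<open>*s\<close>, so that a
  complex-linear derivative composed with it is again multiplication by a complex number.
\<close>
lemma has_derivative_vec_lambda:
  fixes \<psi> :: "'n::finite \<Rightarrow> complex \<Rightarrow> complex"
  assumes "\<And>j. (\<psi> j has_field_derivative d j) (at w)"
  shows "((\<lambda>w. \<chi> j. \<psi> j w) has_derivative (\<lambda>h. h *s (\<chi> j. d j))) (at w)"
proof (subst has_derivative_componentwise_within, intro ballI)
  fix b :: "complex ^ 'n" assume "b \<in> Basis"
  then obtain j c where b: "b = axis j c" by (auto simp: Basis_vec_def)
  have "((\<lambda>w. \<psi> j w \<bullet> c) has_derivative (\<lambda>h. (d j * h) \<bullet> c)) (at w)"
    using assms[of j] unfolding has_field_derivative_def by (rule has_derivative_inner_left)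
  then show "((\<lambda>w. (\<chi> j. \<psi> j w) \<bullet> b) has_derivative (\<lambda>h. (h *s (\<chi> j. d j)) \<bullet> b)) (at w)"
    by (simp add: b inner_axis mult.commute)
qed

lemma open_unit_polydisk: "open (unit_polydisk :: (complex ^ 'n::finite) set)"
  proof -
  have "(unit_polydisk :: (complex ^ 'n) set) = (\<Inter>j. {z. norm (z $ j) < 1})"
    by (auto simp: unit_polydisk_def)
  moreover have "open (\<Inter>j. {z :: complex ^ 'n. norm (z $ j) < 1})"
    by (intro open_INT finite ballI open_Collect_less continuous_intros)
  ultimately show ?thesis by simp
qed

lemma holomorphic_map_on_polydisk_derivative:
  assumes "holomorphic_map_on f unit_polydisk" "z \<in> unit_polydisk"
  obtains L where "(f has_derivative L) (at z)" "\<And>c v. L (c *s v) = c *s L v"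
  using assms open_unit_polydisk
  unfolding holomorphic_map_on_def by (metis at_within_open)

lemma complex_linear_basis_expansion:
  fixes L :: "complex ^ 'n::finite \<Rightarrow> complex ^ 'm::finite"
  assumes "linear L" and "\<And>c v. L (c *s v) = c *s L v"
  shows "L v = (\<Sum>j\<in>UNIV. v $ j *s L (axis j 1))"
proof -
  have "L v = L (\<Sum>j\<in>UNIV. v $ j *s axis j 1)" by (simp add: basis_expansion)
  then show ?thesis by (simp add: linear_sum[OF assms(1)] assms(2))
qed

text \<open>
  The sum on the left is the derivative of \<open>f\<close> in the direction \<open>(\<zeta>\<^sub>j (1 - |z\<^sub>j|\<^sup>2))\<^sub>j\<close>, which is
  the velocity at \<open>0\<close> of a disc through \<open>z\<close> whose coordinates are rotated disc automorphisms.
  Keeping the \<open>\<zeta>\<^sub>j\<close> and \<open>e\<close> free is what makes the inequality strong enough to control a sum over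
  all the variables.
\<close>
lemma polydisk_Schwarz_Pick:
  fixes f :: "complex ^ 'n::finite \<Rightarrow> complex ^ 'm::finite"
  assumes hol: "holomorphic_map_on f unit_polydisk"
    and f1: "f ` unit_polydisk \<subseteq> ball 0 1"
    and z: "z \<in> unit_polydisk"
    and L: "(f has_derivative L) (at z)" "\<And>c v. L (c *s v) = c *s L v"
    and \<zeta>: "\<And>j. norm (\<zeta> j) = 1"
    and e: "norm e \<le> 1"
  shows "norm (hermitian (\<Sum>j\<in>UNIV. (\<zeta> j * of_real (1 - (norm (z $ j))\<^sup>2)) *s L (axis j 1)) e)
           \<le> 1 - (norm (hermitian (f z) e))\<^sup>2"
proof -
  have zj: "norm (- (z $ j)) < 1" for j using z by (simp add: unit_polydisk_def)
  define \<psi> where "\<psi> j w = Moebius_function 0 (- (z $ j)) (\<zeta> j * w)" for j w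
  define \<Psi> where "\<Psi> w = (\<chi> j. \<psi> j w)" for w
  define g where "g w = hermitian (f (\<Psi> w)) e" for w
  have \<Psi>0: "\<Psi> 0 = z" by (simp add: \<Psi>_def \<psi>_def Moebius_function_def)
  have \<Psi>in: "\<Psi> w \<in> unit_polydisk" if "norm w < 1" for w
    using Moebius_function_norm_lt_1[OF zj] \<zeta> that
    by (simp add: unit_polydisk_def \<Psi>_def \<psi>_def norm_mult)
  have hol\<psi>: "\<psi> j holomorphic_on ball 0 1" for j
  proof -
    have "(Moebius_function 0 (- (z $ j)) \<circ> (\<lambda>w. \<zeta> j * w)) holomorphic_on ball 0 1"
      by (rule holomorphic_on_compose_gen[OF _ Moebius_function_holomorphic[OF zj]])
         (use \<zeta> in \<open>auto intro!: holomorphic_intros simp: norm_mult\<close>)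
    then show ?thesis by (simp add: o_def \<psi>_def[abs_def])
  qed
  \<comment> \<open>Complex linearity of the derivative of \<open>f\<close> makes \<open>g\<close> complex differentiable. The rule is
      needed at every \<open>w\<close> for holomorphy, and at \<open>0\<close> for the value of the derivative.\<close>
  have chain: "(g has_field_derivative hermitian (K (\<chi> j. d j)) e) (at w)"
    if "\<And>j. (\<psi> j has_field_derivative d j) (at w)"
      and K: "(f has_derivative K) (at (\<Psi> w))" "\<And>c v. K (c *s v) = c *s K v" for d w K
  proof -
    have \<Psi>': "(\<Psi> has_derivative (\<lambda>h. h *s (\<chi> j. d j))) (at w)"
      unfolding \<Psi>_def[abs_def] by (rule has_derivative_vec_lambda[OF that(1)])
    have "(g has_derivative (\<lambda>h. hermitian (K (h *s (\<chi> j. d j))) e)) (at w)"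
      unfolding g_def[abs_def]
      by (rule bounded_linear.has_derivative[OF bounded_linear_hermitian
            has_derivative_compose[OF \<Psi>' K(1)]])
    moreover have "(\<lambda>h. hermitian (K (h *s (\<chi> j. d j))) e) = (*) (hermitian (K (\<chi> j. d j)) e)"
      by (rule ext) (simp add: K(2) hermitian_smult mult.commute)
    ultimately show ?thesis
      by (simp add: has_field_derivative_def)
  qed
  have "\<exists>D. (g has_field_derivative D) (at w)" if "norm w < 1" for w
  proof -
    have "\<exists>d. (\<psi> j has_field_derivative d) (at w)" for j
      using holomorphic_derivI[OF hol\<psi>, of w] that by auto
    then show ?thesis
      using chain holomorphic_map_on_polydisk_derivative[OF hol \<Psi>in[OF that]] by metis
  qed
  then have holg: "g holomorphic_on ball 0 1"
    unfolding holomorphic_on_def field_differentiable_def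
    by (meson has_field_derivative_at_within mem_ball_0)
  have g1: "norm (g w) < 1" if "norm w < 1" for w
  proof -
    have "norm (f (\<Psi> w)) < 1" using f1 \<Psi>in[OF that] by auto
    moreover have "norm (g w) \<le> norm (f (\<Psi> w)) * norm e"
      unfolding g_def by (rule norm_hermitian_le)
    moreover have "norm (f (\<Psi> w)) * norm e \<le> norm (f (\<Psi> w)) * 1"
      using e by (intro mult_left_mono) auto
    ultimately show ?thesis by simp
  qed
  \<comment> \<open>A disc automorphism that sends \<open>0\<close> to \<open>z\<^sub>j\<close> has a derivative of modulus \<open>1 - |z\<^sub>j|\<^sup>2\<close> at
      \<open>0\<close>; this is the origin of the weights.\<close>
  have "(\<psi> j has_field_derivative \<zeta> j * of_real (1 - (norm (z $ j))\<^sup>2)) (at 0)" for j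
  proof -
    have "((\<lambda>w. (\<zeta> j * w - (- (z $ j))) / (1 - cnj (- (z $ j)) * (\<zeta> j * w)))
        has_field_derivative \<zeta> j - z $ j * (cnj (z $ j) * \<zeta> j)) (at 0)"
      by (auto intro!: derivative_eq_intros)
    moreover have "\<zeta> j - z $ j * (cnj (z $ j) * \<zeta> j) = \<zeta> j * of_real (1 - (norm (z $ j))\<^sup>2)"
      unfolding of_real_diff complex_norm_square by (simp add: algebra_simps)
    ultimately show ?thesis
      by (simp only: \<psi>_def[abs_def] Moebius_function_simple)
  qed
  from chain[OF this, of L] L \<Psi>0
  have "deriv g 0 = hermitian (L (\<chi> j. \<zeta> j * of_real (1 - (norm (z $ j))\<^sup>2))) e"
    by (auto intro: DERIV_imp_deriv)
  also have "L (\<chi> j. \<zeta> j * of_real (1 - (norm (z $ j))\<^sup>2))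
      = (\<Sum>j\<in>UNIV. (\<zeta> j * of_real (1 - (norm (z $ j))\<^sup>2)) *s L (axis j 1))"
    by (subst complex_linear_basis_expansion[OF has_derivative_linear[OF L(1)] L(2)]) simp
  finally show ?thesis
    using Schwarz_Pick_at_0[OF holg g1] by (simp add: g_def \<Psi>0)
qed

section \<open>Choosing signs\<close>

text \<open>
  The cross terms of \<open>|\<Sum>\<^sub>j s\<^sub>j a\<^sub>j|\<^sup>2\<close> cancel in the mean over all signs, so some choice attains at
  least the sum of the squares. A greedy choice does: each new vector is given the sign that makes
  its inner product with the sum so far nonnegative.
\<close>
lemma signs_norm_sum_ge:
  fixes a :: "'j \<Rightarrow> 'v::real_inner"
  assumes "finite J"
  shows "\<exists>s. (\<forall>j. s j = 1 \<or> s j = -1) \<and> (\<Sum>j\<in>J. (norm (a j))\<^sup>2) \<le> (norm (\<Sum>j\<in>J. s j *\<^sub>R a j))\<^sup>2"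
  using assms
proof (induction J rule: finite_induct)
  case empty
  then show ?case by (auto intro: exI[of _ "\<lambda>_. 1"])
next
  case (insert k J)
  then obtain s where s: "\<And>j. s j = 1 \<or> s j = (-1 :: real)"
    "(\<Sum>j\<in>J. (norm (a j))\<^sup>2) \<le> (norm (\<Sum>j\<in>J. s j *\<^sub>R a j))\<^sup>2" by blast
  define v where "v = (\<Sum>j\<in>J. s j *\<^sub>R a j)"
  define c where "c = (if a k \<bullet> v \<ge> 0 then 1 else -1 :: real)"
  have c: "(c = 1 \<or> c = -1) \<and> c * (a k \<bullet> v) \<ge> 0" by (auto simp: c_def)
  have "(\<Sum>j\<in>J. (s(k := c)) j *\<^sub>R a j) = v"
    unfolding v_def using insert.hyps by (intro sum.cong) auto
  then have "(\<Sum>j\<in>insert k J. (s(k := c)) j *\<^sub>R a j) = c *\<^sub>R a k + v"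
    using insert.hyps by simp
  moreover have "(norm (c *\<^sub>R a k + v))\<^sup>2 = (norm (a k))\<^sup>2 + 2 * (c * (a k \<bullet> v)) + (norm v)\<^sup>2"
    using dot_norm[of "c *\<^sub>R a k" v] c by auto
  ultimately show ?case
    using s c insert.hyps by (intro exI[of _ "s(k := c)"]) (auto simp: v_def)
qed

section \<open>One-sided directional derivatives of the norm\<close>

lemma has_derivative_right_difference_quotient:
  fixes f :: "'a::real_normed_vector \<Rightarrow> 'b::real_normed_vector"
  assumes "(f has_derivative L) (at z)"
  shows "((\<lambda>t. (f (z + t *\<^sub>R v) - f z) /\<^sub>R t) \<longlongrightarrow> L v) (at_right 0)"
proof -
  interpret L: bounded_linear L using assms by (rule has_derivative_bounded_linear)
  have "((\<lambda>t::real. z + t *\<^sub>R v) has_derivative (\<lambda>t. t *\<^sub>R v)) (at 0)"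
    using has_derivative_add[OF has_derivative_const has_derivative_scaleR_left[OF has_derivative_ident]]
    by simp
  then have "((\<lambda>t::real. f (z + t *\<^sub>R v)) has_derivative (\<lambda>t. L (t *\<^sub>R v))) (at 0)"
    by (rule has_derivative_compose) (use assms in simp)
  then have "((\<lambda>t::real. (f (z + t *\<^sub>R v) - f z - t *\<^sub>R L v) /\<^sub>R \<bar>t\<bar>) \<longlongrightarrow> 0) (at 0)"
    by (simp add: has_derivative_at_within L.scaleR)
  then have "((\<lambda>t::real. (f (z + t *\<^sub>R v) - f z - t *\<^sub>R L v) /\<^sub>R \<bar>t\<bar>) \<longlongrightarrow> 0) (at_right 0)"
    by (rule tendsto_mono[rotated]) (simp add: at_le)
  moreover have "\<forall>\<^sub>F t in at_right 0. (f (z + t *\<^sub>R v) - f z - t *\<^sub>R L v) /\<^sub>R \<bar>t\<bar>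
      = (f (z + t *\<^sub>R v) - f z) /\<^sub>R t - L v"
    using eventually_at_right_less[of "0::real"]
    by eventually_elim (simp add: scaleR_diff_right)
  ultimately have "((\<lambda>t. (f (z + t *\<^sub>R v) - f z) /\<^sub>R t - L v) \<longlongrightarrow> 0) (at_right 0)"
    by (rule Lim_transform_eventually)
  then show ?thesis by (rule LIM_zero_cancel)
qed

lemma axis_real_mult: "axis j (of_real t * \<beta>) = t *\<^sub>R axis j (\<beta> :: complex)"
  by (simp add: axis_def vec_eq_iff scaleR_conv_of_real[where 'a = complex])

lemma axis_eq_smult: "axis j \<beta> = \<beta> *s axis j (1 :: complex)"
  by (simp add: axis_def vec_eq_iff)

text \<open>
  Away from the zeros of \<open>f\<close> the norm is differentiable, and the derivative of \<open>|f|\<close> in the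
  direction \<open>\<beta>\<close> of the \<open>j\<close>-th variable is the real part of \<open>\<beta>\<close> times a fixed complex number.
\<close>
lemma nabla_abs_norm_le:
  assumes L: "(f has_derivative L) (at z)" "\<And>c v. L (c *s v) = c *s L v" and fz: "f z \<noteq> 0"
  shows "nabla_abs j (\<lambda>w. norm (f w)) z \<le> norm (hermitian (L (axis j 1)) (sgn (f z)))"
  unfolding nabla_abs_def
proof (rule cSUP_least)
  show "{\<beta>::complex. norm \<beta> = 1} \<noteq> {}" by (auto intro: exI[of _ 1])
  fix \<beta> :: complex assume "\<beta> \<in> {\<beta>. norm \<beta> = 1}"
  then have \<beta>: "norm \<beta> = 1" by simp
  have "((\<lambda>w. norm (f w)) has_derivative (\<lambda>v. L v \<bullet> sgn (f z))) (at z)"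
    by (rule has_derivative_compose[OF L(1) has_derivative_norm[OF fz]])
  from has_derivative_right_difference_quotient[OF this, of "axis j \<beta>"]
  have "Lim (at_right 0) (\<lambda>t. (norm (f (z + axis j (of_real t * \<beta>))) - norm (f z)) / t)
      = L (axis j \<beta>) \<bullet> sgn (f z)"
    by (intro tendsto_Lim) (simp_all add: axis_real_mult divide_inverse_commute)
  also have "\<dots> = Re (\<beta> * hermitian (L (axis j 1)) (sgn (f z)))"
    by (subst axis_eq_smult) (simp only: L(2) hermitian_smult flip: Re_hermitian)
  also have "\<dots> \<le> norm (hermitian (L (axis j 1)) (sgn (f z)))"
    using complex_Re_le_cmod[of "\<beta> * hermitian (L (axis j 1)) (sgn (f z))"] \<beta>
    by (simp add: norm_mult)
  finally show "Lim (at_right 0) (\<lambda>t. (norm (f (z + axis j (of_real t * \<beta>))) - norm (f z)) / t)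
      \<le> norm (hermitian (L (axis j 1)) (sgn (f z)))" .
qed

text \<open>
  At a zero of \<open>f\<close> the difference quotient of \<open>|f|\<close> is, for positive \<open>t\<close>, the norm of the
  difference quotient of \<open>f\<close>. Its limit does not depend on \<open>\<beta>\<close>, so the supremum is over a constant.
\<close>
lemma nabla_abs_norm_at_zero:
  assumes L: "(f has_derivative L) (at z)" "\<And>c v. L (c *s v) = c *s L v" and fz: "f z = 0"
  shows "nabla_abs j (\<lambda>w. norm (f w)) z = norm (L (axis j 1))"
proof -
  have "Lim (at_right 0) (\<lambda>t. (norm (f (z + axis j (of_real t * \<beta>))) - norm (f z)) / t)
      = norm (L (axis j 1))" if "norm \<beta> = 1" for \<beta> :: complex
  proof (rule tendsto_Lim)
    have "((\<lambda>t. norm ((f (z + t *\<^sub>R axis j \<beta>) - f z) /\<^sub>R t)) \<longlongrightarrow> norm (L (axis j \<beta>))) (at_right 0)"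
      by (rule tendsto_norm[OF has_derivative_right_difference_quotient[OF L(1)]])
    moreover have "norm (L (axis j \<beta>)) = norm (L (axis j 1))"
      by (subst axis_eq_smult) (simp add: L(2) norm_vector_smult that)
    moreover have "\<forall>\<^sub>F t in at_right 0. norm ((f (z + t *\<^sub>R axis j \<beta>) - f z) /\<^sub>R t)
        = (norm (f (z + axis j (of_real t * \<beta>))) - norm (f z)) / t"
      using eventually_at_right_less[of "0::real"]
      by eventually_elim (simp add: fz axis_real_mult divide_inverse_commute)
    ultimately show "((\<lambda>t. (norm (f (z + axis j (of_real t * \<beta>))) - norm (f z)) / t)
        \<longlongrightarrow> norm (L (axis j 1))) (at_right 0)"
      by (auto intro: Lim_transform_eventually)
  qed simp
  then have "nabla_abs j (\<lambda>w. norm (f w)) z = (SUP \<beta>\<in>{\<beta>::complex. norm \<beta> = 1}. norm (L (axis j 1)))"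
    unfolding nabla_abs_def by (intro SUP_cong) auto
  moreover have "{\<beta>::complex. norm \<beta> = 1} \<noteq> {}" by (auto intro: exI[of _ 1])
  ultimately show ?thesis by simp
qed

section \<open>The inequalities for the gradient of the norm\<close>

theorem theorem1:
  fixes f :: "complex ^ 'n::finite \<Rightarrow> complex ^ 'm::finite" and z :: "complex ^ 'n"
  assumes "CARD('m) \<ge> 2"
    and "holomorphic_map_on f unit_polydisk"
    and "f ` unit_polydisk \<subseteq> ball 0 1"
    and "z \<in> unit_polydisk"
  shows "(f z \<noteq> 0 \<longrightarrow>
            (\<Sum>j\<in>UNIV. (1 - (norm (z $ j))\<^sup>2) * nabla_abs j (\<lambda>w. norm (f w)) z)
              \<le> 1 - (norm (f z))\<^sup>2) \<and>
         (f z = 0 \<longrightarrow>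
            (\<Sum>j\<in>UNIV. (1 - (norm (z $ j))\<^sup>2)\<^sup>2 * (nabla_abs j (\<lambda>w. norm (f w)) z)\<^sup>2)
              \<le> 1)"
proof -
  obtain L where L: "(f has_derivative L) (at z)" "\<And>c v. L (c *s v) = c *s L v"
    using holomorphic_map_on_polydisk_derivative[OF assms(2,4)] by metis
  note SP = polydisk_Schwarz_Pick[OF assms(2-4) L]
  define r where "r j = 1 - (norm (z $ j))\<^sup>2" for j
  have r: "r j \<ge> 0" for j
    using assms(4) by (simp add: r_def unit_polydisk_def power_le_one less_imp_le)
  have "(\<Sum>j\<in>UNIV. r j * nabla_abs j (\<lambda>w. norm (f w)) z) \<le> 1 - (norm (f z))\<^sup>2" if fz: "f z \<noteq> 0"
  proof -
    define h where "h j = hermitian (L (axis j 1)) (sgn (f z))" for j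
    \<comment> \<open>Rotations that align the summands along the positive real axis; where \<open>h j = 0\<close> any
        unimodular value does.\<close>
    define \<zeta> where "\<zeta> j = (if h j = 0 then 1 else cnj (sgn (h j)))" for j
    have \<zeta>: "norm (\<zeta> j) = 1" for j by (simp add: \<zeta>_def norm_sgn)
    have \<zeta>h: "\<zeta> j * h j = of_real (norm (h j))" for j
    proof (cases "h j = 0")
      case False
      have "\<zeta> j * h j = h j * cnj (h j) / of_real (norm (h j))"
        using False by (simp add: \<zeta>_def sgn_eq)
      also have "h j * cnj (h j) = of_real (norm (h j)) * of_real (norm (h j))"
        by (simp flip: complex_norm_square add: power2_eq_square)
      finally show ?thesis using False by simp
    qed simp
    have "(\<Sum>j\<in>UNIV. r j * nabla_abs j (\<lambda>w. norm (f w)) z) \<le> (\<Sum>j\<in>UNIV. r j * norm (h j))"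
      unfolding h_def by (intro sum_mono mult_left_mono nabla_abs_norm_le L fz r)
    also have "\<dots> = Re (\<Sum>j\<in>UNIV. (\<zeta> j * of_real (r j)) * h j)"
    proof -
      have "(\<zeta> j * of_real (r j)) * h j = of_real (r j * norm (h j))" for j
        using \<zeta>h[of j] by (simp add: mult.assoc mult.left_commute[of "\<zeta> j"])
      then show ?thesis by (simp del: of_real_mult)
    qed
    also have "(\<Sum>j\<in>UNIV. (\<zeta> j * of_real (r j)) * h j)
        = hermitian (\<Sum>j\<in>UNIV. (\<zeta> j * of_real (r j)) *s L (axis j 1)) (sgn (f z))"
      by (simp add: h_def hermitian_smult
          linear_sum[OF bounded_linear.linear[OF bounded_linear_hermitian]])
    also have "Re \<dots> \<le> norm \<dots>" by (rule complex_Re_le_cmod)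
    also have "\<dots> \<le> 1 - (norm (f z))\<^sup>2"
      using SP[of \<zeta> "sgn (f z)", OF \<zeta>] by (simp add: r_def hermitian_sgn norm_sgn)
    finally show ?thesis .
  qed
  moreover have "(\<Sum>j\<in>UNIV. (r j)\<^sup>2 * (nabla_abs j (\<lambda>w. norm (f w)) z)\<^sup>2) \<le> 1" if fz: "f z = 0"
  proof -
    define a where "a j = r j *\<^sub>R L (axis j 1)" for j
    obtain s where s: "\<And>j. s j = 1 \<or> s j = (-1 :: real)"
      "(\<Sum>j\<in>UNIV. (norm (a j))\<^sup>2) \<le> (norm (\<Sum>j\<in>UNIV. s j *\<^sub>R a j))\<^sup>2"
      using signs_norm_sum_ge[OF finite_class.finite_UNIV, of a] by blast
    define v where "v = (\<Sum>j\<in>UNIV. s j *\<^sub>R a j)"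
    have v: "v = (\<Sum>j\<in>UNIV. (of_real (s j) * of_real (r j)) *s L (axis j 1))"
      by (simp add: v_def a_def vec_eq_iff scaleR_conv_of_real[where 'a = complex] mult.assoc)
    \<comment> \<open>Pairing \<open>v\<close> with its own direction recovers \<open>norm v\<close>; since \<open>sgn 0 = 0\<close> has norm at most
        1, \<open>v = 0\<close> is covered as well.\<close>
    have "norm (s j) = 1" for j using s(1)[of j] by auto
    then have "norm (hermitian v (sgn v)) \<le> 1"
      using SP[of "\<lambda>j. of_real (s j)" "sgn v"] by (simp add: v r_def norm_sgn fz hermitian_def[of 0])
    then have "norm v \<le> 1" by (simp add: hermitian_sgn)
    then have "(norm v)\<^sup>2 \<le> 1" by (simp add: power_le_one)
    moreover have "(r j)\<^sup>2 * (nabla_abs j (\<lambda>w. norm (f w)) z)\<^sup>2 = (norm (a j))\<^sup>2" for j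
      by (simp add: nabla_abs_norm_at_zero[OF L fz] a_def power_mult_distrib)
    ultimately show ?thesis using s(2) by (simp add: v_def)
  qed
  ultimately show ?thesis by (simp add: r_def)
qed

end
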